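(* Let $d\in\mathbb{N}$. There exist three positive constants $C_1(d),C_2(d),C_3(d)$, depending only on $d$, such that for any $n,v\in\mathbb{N}$ with $v\le|\Pi_n|$ there is a set $\xi=\{\xi^\nu\}_{\nu=1}^m\subset\mathbb{T}^d$, with $m\le C_1(d)v^2n$, which provides universal discretization in $L_2$ for the collection $\mathcal{S}(v,n)$: for any $f\in\bigcup_{Q\in\mathcal{S}(v,n)}\mathcal{T}(Q)$, $$C_2(d)\|f\|_2^2\le\frac1m\sum_{\nu=1}^m|f(\xi^\nu)|^2\le C_3(d)\|f\|_2^2 .$$
   Context: $\mathbb{T}^d$ is the $d$-dimensional torus $[0,2\pi)^d$ with normalized Lebesgue measure $\mu$, and $\|f\|_2=(\int_{\mathbb{T}^d}|f|^2d\mu)^{1/2}$. For a finite set $Q\subset\mathbb{Z}^d$, $\mathcal{T}(Q):=\{f:\ f(\mathbf{x})=\sum_{\mathbf{k}\in Q}c_{\mathbf{k}}e^{i(\mathbf{k},\mathbf{x})},\ c_{\mathbf{k}}\in\mathbb{C}\}$. For $n\in\mathbb{N}$, $\Pi_n:=\{\mathbf{k}\in\mathbb{Z}^d:\ |k_j|\le 2^{n-1}-1,\ j=1,\dots,d\}$, and $\mathcal{S}(v,n):=\{Q\subset\Pi_n:\ |Q|=v\}$, where $|\cdot|$ denotes cardinality. *)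

theory Defs
  imports "HOL-Analysis.Analysis"
begin

definition torus :: "(real^'d::finite) set" where
  "torus = {x. \<forall>j. 0 \<le> x $ j \<and> x $ j < 2 * pi}"

definition torus_measure :: "(real^'d::finite) measure" where
  "torus_measure = uniform_measure lborel torus"

definition L2_torus :: "(real^'d::finite \<Rightarrow> complex) \<Rightarrow> real" where
  "L2_torus f = sqrt (LINT x|torus_measure. (norm (f x))\<^sup>2)"

definition frequency_pairing :: "int^'d::finite \<Rightarrow> real^'d \<Rightarrow> real" where
  "frequency_pairing k x = (\<Sum>j\<in>UNIV. real_of_int (k $ j) * x $ j)"

(* The polynomials are taken as (2 * pi)-periodic functions on all of R^d;
   only their values on the torus are used. *)
definition trig_polys :: "(int^'d::finite) set \<Rightarrow> (real^'d \<Rightarrow> complex) set" where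
  "trig_polys Q =
     {f. \<exists>c :: int^'d \<Rightarrow> complex.
           \<forall>x. f x = (\<Sum>k\<in>Q. c k * exp (\<i> * of_real (frequency_pairing k x)))}"

(* Meant for n \<ge> 1, where n - 1 on nat does not truncate. *)
definition freq_cube :: "nat \<Rightarrow> (int^'d::finite) set" where
  "freq_cube n = {k. \<forall>j. \<bar>k $ j\<bar> \<le> 2 ^ (n - 1) - 1}"

definition freq_subsets :: "nat \<Rightarrow> nat \<Rightarrow> (int^'d::finite) set set" where
  "freq_subsets v n = {Q. Q \<subseteq> freq_cube n \<and> card Q = v}"

end

theory Submission imports Defs "HOL-Probability.Hoeffding" begin

text \<open>
  For \<open>f\<close> with spectrum \<open>Q\<close>, the sample average of \<open>\<bar>f\<bar>\<^sup>2\<close> is a quadratic form in the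
  coefficients whose matrix entries are the normalized exponential sums at the differences of
  elements of \<open>Q\<close>. If these are at most \<open>1 / (2 v)\<close> for all nonzero differences of elements of
  the cube, Cauchy--Schwarz shows that the form deviates from \<open>\<parallel>f\<parallel>\<^sup>2\<close> by at most half of it.
  There are at most \<open>2 ^ (2 n d)\<close> such differences, so such points exist for \<open>m\<close> of order
  \<open>v\<^sup>2 n d\<close>: choose them one at a time so that the sum over all differences of the exponential
  moments of the partial sums never exceeds the bound that Hoeffding's lemma gives for its mean.
\<close>

section \<open>Exponential moments and the successive choice of points\<close>

text \<open>Hoeffding's lemma on \<open>[-1, 1]\<close>: its exponent
  \<open>l\<^sup>2 * (b - a)\<^sup>2 / 8\<close> becomes \<open>l\<^sup>2 / 2\<close> because
  \<open>b - a = 2\<close>. Integrability serves to pass from the nonnegative integral to the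
  Bochner integral.\<close>

lemma (in prob_space) expectation_exp_le:
  assumes X: "random_variable borel X" and bound: "\<And>x. \<bar>X x\<bar> \<le> (1::real)"
    and mean: "expectation X = 0" and "l > 0"
  shows "integrable M (\<lambda>x. exp (l * X x))" "expectation (\<lambda>x. exp (l * X x)) \<le> exp (l\<^sup>2 / 2)"
proof -
  have [measurable]: "random_variable borel X" by fact
  show int: "integrable M (\<lambda>x. exp (l * X x))"
    using bound \<open>l > 0\<close> by (intro integrable_const_bound[of _ "exp l"]) (auto simp: abs_le_iff)
  interpret interval_bounded_random_variable M X "-1" 1
    by unfold_locales (use X bound in \<open>auto simp: abs_le_iff minus_le_iff\<close>)
  have "ennreal (expectation (\<lambda>x. exp (l * X x))) \<le> ennreal (exp (l\<^sup>2 / 2))"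
    using Hoeffdings_lemma_nn_integral_0[OF \<open>l > 0\<close> mean] int
    by (subst nn_integral_eq_integral[symmetric]) auto
  then show "expectation (\<lambda>x. exp (l * X x)) \<le> exp (l\<^sup>2 / 2)"
    by simp
qed

text \<open>The method of conditional expectations: with the earlier points fixed, averaging over
  the next one multiplies the exponential sum by at most \<open>exp (l\<^sup>2 / 2)\<close>, and
  some point does no worse than the average. The assumption \<open>diffuse\<close> makes it possible
  to keep the points distinct.\<close>

lemma (in prob_space) ex_points_exp_sum_le:
  fixes X :: "'i \<Rightarrow> 'a \<Rightarrow> real"
  assumes X: "\<And>i. i \<in> I \<Longrightarrow> random_variable borel (X i)"
    and bound: "\<And>i x. i \<in> I \<Longrightarrow> \<bar>X i x\<bar> \<le> 1"
    and mean: "\<And>i. i \<in> I \<Longrightarrow> expectation (X i) = 0"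
    and "l > 0"
    and diffuse: "\<And>y. AE x in M. x \<noteq> y" and A: "AE x in M. x \<in> A"
  shows "\<exists>\<xi>. inj_on \<xi> {1..m::nat} \<and> \<xi> ` {1..m} \<subseteq> A \<and>
    (\<Sum>i\<in>I. exp (l * (\<Sum>\<nu>=1..m. X i (\<xi> \<nu>)))) \<le> real (card I) * exp (real m * l\<^sup>2 / 2)"
proof (induction m)
  case 0
  show ?case by simp
next
  case (Suc m)
  then obtain \<xi> where inj: "inj_on \<xi> {1..m}" and sub: "\<xi> ` {1..m} \<subseteq> A"
    and le: "(\<Sum>i\<in>I. exp (l * (\<Sum>\<nu>=1..m. X i (\<xi> \<nu>)))) \<le> real (card I) * exp (real m * l\<^sup>2 / 2)"
    by blast
  \<comment> \<open>The earlier points enter only through the fixed weights \<open>w i\<close>;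
    \<open>\<Phi> x\<close> is the exponential sum after \<open>x\<close> has been appended as point
    \<open>Suc m\<close>.\<close>
  define w where "w = (\<lambda>i. exp (l * (\<Sum>\<nu>=1..m. X i (\<xi> \<nu>))))"
  define \<Phi> where "\<Phi> = (\<lambda>x. \<Sum>i\<in>I. w i * exp (l * X i x))"
  define B where "B = real (card I) * exp (real (Suc m) * l\<^sup>2 / 2)"
  have int: "integrable M (\<lambda>x. exp (l * X i x))"
    and E: "expectation (\<lambda>x. exp (l * X i x)) \<le> exp (l\<^sup>2 / 2)" if "i \<in> I" for i
    using expectation_exp_le[OF X bound mean \<open>l > 0\<close>] that by auto
  have int\<Phi>: "integrable M \<Phi>"
    unfolding \<Phi>_def using int by auto
  have "expectation \<Phi> = (\<Sum>i\<in>I. w i * expectation (\<lambda>x. exp (l * X i x)))"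
    unfolding \<Phi>_def using int by (simp add: Bochner_Integration.integral_sum)
  also have "\<dots> \<le> (\<Sum>i\<in>I. w i * exp (l\<^sup>2 / 2))"
    using E by (intro sum_mono mult_left_mono) (auto simp: w_def)
  also have "\<dots> = (\<Sum>i\<in>I. w i) * exp (l\<^sup>2 / 2)"
    by (simp add: sum_distrib_right)
  also have "\<dots> \<le> (real (card I) * exp (real m * l\<^sup>2 / 2)) * exp (l\<^sup>2 / 2)"
    using le by (intro mult_right_mono) (auto simp: w_def)
  also have "\<dots> = B"
    by (simp add: B_def mult_exp_exp algebra_simps add_divide_distrib)
  finally have EB: "expectation \<Phi> \<le> B" .
  \<comment> \<open>Each earlier point is a null set and there are finitely many, so a new point
    avoids them almost surely.\<close>
  have "AE x in M. \<forall>y\<in>\<xi> ` {1..m}. x \<noteq> y"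
    by (intro AE_finite_allI diffuse) auto
  with A have AE: "AE x in M. x \<in> A \<and> x \<notin> \<xi> ` {1..m}"
    by eventually_elim auto
  \<comment> \<open>Otherwise \<open>\<Phi>\<close> would exceed \<open>B\<close> almost everywhere,
    and hence so would its mean.\<close>
  have "\<exists>x. x \<in> A \<and> x \<notin> \<xi> ` {1..m} \<and> \<Phi> x \<le> B"
  proof (rule ccontr)
    assume "\<nexists>x. x \<in> A \<and> x \<notin> \<xi> ` {1..m} \<and> \<Phi> x \<le> B"
    with AE have "AE x in M. B < \<Phi> x"
      by (elim eventually_mono) (meson not_le)
    then have "B < expectation \<Phi>"
      by (intro expectation_greater int\<Phi>)
    with EB show False by simp
  qed
  then obtain x where x: "x \<in> A" "x \<notin> \<xi> ` {1..m}" "\<Phi> x \<le> B"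
    by blast
  let ?\<xi> = "\<xi>(Suc m := x)"
  have ivl: "{1..Suc m} = insert (Suc m) {1..m}" by auto
  have upd: "?\<xi> ` {1..m} = \<xi> ` {1..m}" by (rule image_cong) auto
  have "inj_on ?\<xi> {1..Suc m}"
    unfolding ivl inj_on_insert using inj_on_fun_updI[OF inj x(2)] x(2) upd by simp
  moreover have "?\<xi> ` {1..Suc m} \<subseteq> A"
    unfolding ivl image_insert upd using x(1) sub by simp
  moreover have "(\<Sum>i\<in>I. exp (l * (\<Sum>\<nu>=1..Suc m. X i (?\<xi> \<nu>)))) = \<Phi> x"
    unfolding \<Phi>_def w_def by (simp add: mult_exp_exp algebra_simps)
  ultimately show ?case
    using x(3) unfolding B_def by metis
qed

section \<open>Orthogonality of the exponentials on the torus\<close>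

text \<open>Fubini for a product of one-variable functions, with \<open>lborel\<close> seen as the
  image of a product of copies of the real line. The factors are indexed by basis vectors because
  that product is.\<close>

lemma integral_lborel_prod:
  fixes f :: "'a::euclidean_space \<Rightarrow> real \<Rightarrow> 'b::{real_normed_field,banach,second_countable_topology}"
  assumes "\<And>b. b \<in> Basis \<Longrightarrow> integrable lborel (f b)"
  shows "(LINT x|lborel. (\<Prod>b\<in>Basis. f b (x \<bullet> b))) = (\<Prod>b\<in>Basis. LINT t|lborel. f b t)"
proof -
  interpret product_sigma_finite "\<lambda>_::'a. lborel :: real measure" ..
  have [measurable]: "f b \<in> borel_measurable borel" if "b \<in> Basis" for b
    using assms[OF that] by (auto dest: borel_measurable_integrable)
  have "(LINT x|lborel. (\<Prod>b\<in>Basis. f b (x \<bullet> b))) =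
      (LINT g|(\<Pi>\<^sub>M b\<in>Basis. lborel). (\<Prod>b\<in>Basis. f b (g b)))"
    by (subst lborel_eq, subst integral_distr)
      (auto intro!: Bochner_Integration.integral_cong prod.cong simp: inner_sum_left inner_Basis if_distrib cong: if_cong)
  also have "\<dots> = (\<Prod>b\<in>Basis. LINT t|lborel. f b t)"
    by (rule product_integral_prod) (use assms in auto)
  finally show ?thesis .
qed

lemma prod_Basis_vec:
  "(\<Prod>b\<in>Basis. f b) = (\<Prod>j\<in>UNIV. f (axis j (1::real) :: real^'d::finite))"
proof -
  have Basis: "(Basis :: (real^'d) set) = (\<lambda>j. axis j 1) ` UNIV"
    by (auto simp: Basis_vec_def)
  have "inj (\<lambda>j. axis j (1::real) :: real^'d)"
    by (auto simp: inj_on_def axis_eq_axis)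
  then show ?thesis
    unfolding Basis by (subst prod.reindex) simp_all
qed

definition trig_monomial :: "int^'d::finite \<Rightarrow> real^'d \<Rightarrow> complex" where
  "trig_monomial k x = exp (\<i> * of_real (frequency_pairing k x))"

lemma norm_trig_monomial [simp]: "norm (trig_monomial k x) = 1"
  by (simp add: trig_monomial_def)

lemma trig_monomial_zero [simp]: "trig_monomial 0 x = 1"
  by (simp add: trig_monomial_def frequency_pairing_def)

lemma trig_monomial_mult_cnj:
  "trig_monomial k x * cnj (trig_monomial l x) = trig_monomial (k - l) x"
  by (simp add: trig_monomial_def frequency_pairing_def exp_cnj mult_exp_exp
      sum_subtractf algebra_simps)

lemma trig_monomial_prod: "trig_monomial k x = (\<Prod>j\<in>UNIV. exp (\<i> * of_int (k $ j) * of_real (x $ j)))"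
  by (simp add: trig_monomial_def frequency_pairing_def sum_distrib_left exp_sum mult.assoc)

lemma trig_monomial_measurable [measurable]: "trig_monomial k \<in> borel_measurable borel"
  unfolding trig_monomial_def frequency_pairing_def by measurable

text \<open>For \<open>k \<noteq> 0\<close> the integrand has the \<open>2 * pi\<close>-periodic
  primitive \<open>?F\<close>. The half-open interval matches \<open>torus\<close>; adding the null
  point \<open>2 * pi\<close> makes the fundamental theorem on a closed interval applicable.\<close>

lemma integral_indicator_exp_period:
  assumes "k \<noteq> 0"
  shows "(LINT t|lborel. indicat_real {0..<2*pi} t *\<^sub>R exp (\<i> * of_int k * of_real t)) = 0"
proof -
  let ?F = "\<lambda>t. exp (\<i> * of_int k * of_real t) / (\<i> * of_int k)"
  have "(LINT t|lborel. indicat_real {0..<2*pi} t *\<^sub>R exp (\<i> * of_int k * of_real t)) =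
    (LINT t|lborel. indicat_real {0..2*pi} t *\<^sub>R exp (\<i> * of_int k * of_real t))"
  proof (intro integral_cong_AE)
    have "AE t in lborel. t \<noteq> 2 * pi" by (rule AE_lborel_singleton)
    then show "AE t in lborel. indicat_real {0..<2*pi} t *\<^sub>R exp (\<i> * of_int k * of_real t) =
        indicat_real {0..2*pi} t *\<^sub>R exp (\<i> * of_int k * of_real t)"
      by eventually_elim (auto simp: indicator_def)
  qed auto
  also have "\<dots> = ?F (2 * pi) - ?F 0"
  proof (rule integral_FTC_Icc)
    fix t :: real
    show "(?F has_vector_derivative exp (\<i> * of_int k * of_real t)) (at t within {0..2*pi})"
      by (rule has_vector_derivative_real_field)
        (use assms in \<open>auto intro!: derivative_eq_intros\<close>)
  qed (auto intro!: continuous_intros)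
  also have "\<dots> = 0"
    using exp_integer_2pi[of "of_int k"] by (simp add: mult_ac)
  finally show ?thesis .
qed

lemma torus_sets [measurable]: "torus \<in> sets borel"
proof -
  have "torus = (\<Inter>j. {x::real^'d. 0 \<le> x $ j} \<inter> {x. x $ j < 2 * pi})"
    by (auto simp: torus_def)
  also have "\<dots> \<in> sets borel"
    by (intro sets.finite_INT sets.Int borel_open borel_closed closed_halfspace_component_ge_cart open_halfspace_component_lt_cart) auto
  finally show ?thesis by simp
qed

text \<open>The torus lies between the open and the closed box of side \<open>2 * pi\<close>. These
  two facts make its uniform measure a probability measure.\<close>

lemma emeasure_torus:
  "emeasure lborel (torus :: (real^'d::finite) set) \<noteq> 0" "emeasure lborel (torus :: (real^'d) set) \<noteq> \<infinity>"
proof -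
  let ?b = "(\<chi> j. 2 * pi) :: real^'d"
  have sub: "box 0 ?b \<subseteq> torus" "torus \<subseteq> cbox 0 ?b"
    by (auto simp: torus_def mem_box_cart less_imp_le)
  have "0 < emeasure lborel (box 0 ?b)"
    by (subst emeasure_lborel_box) (auto simp: Basis_vec_def inner_axis intro!: prod_pos)
  also have "\<dots> \<le> emeasure lborel (torus :: (real^'d) set)"
    using sub by (intro emeasure_mono) auto
  finally show "emeasure lborel (torus :: (real^'d) set) \<noteq> 0" by simp
  have "emeasure lborel (torus :: (real^'d) set) \<le> emeasure lborel (cbox 0 ?b)"
    using sub by (intro emeasure_mono) auto
  also have "\<dots> < \<infinity>" by (rule emeasure_lborel_cbox_finite)
  finally show "emeasure lborel (torus :: (real^'d) set) \<noteq> \<infinity>" by simp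
qed

lemma prob_space_torus_measure: "prob_space torus_measure"
  unfolding torus_measure_def by (rule prob_space_uniform_measure emeasure_torus)+

lemma sets_torus_measure [measurable_cong, simp]: "sets torus_measure = sets borel"
  by (simp add: torus_measure_def)

lemma AE_torus_measure: "AE x in torus_measure. x \<in> torus" "AE x in torus_measure. x \<noteq> y"
  unfolding torus_measure_def using AE_lborel_singleton[of y]
  by (auto intro!: AE_uniform_measureI elim: eventually_mono)

text \<open>The integral factors over the coordinates, and a coordinate with
  \<open>k $ j \<noteq> 0\<close> contributes the factor 0.\<close>

lemma integral_trig_monomial:
  fixes k :: "int^'d::finite"
  assumes "k \<noteq> 0"
  shows "(LINT x|torus_measure. trig_monomial k x) = 0"
proof -
  define V where "V = measure lborel (torus :: (real^'d) set)"
  have V: "emeasure lborel (torus :: (real^'d) set) = ennreal V"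
    unfolding V_def by (rule emeasure_eq_ennreal_measure) (use emeasure_torus(2) in simp)
  then have "V > 0"
    using emeasure_torus(1)[where 'd='d] by (simp add: ennreal_eq_0_iff not_le)
  have density: "torus_measure = density lborel (\<lambda>x::real^'d. ennreal (indicat_real torus x / V))"
    unfolding torus_measure_def uniform_measure_def V
    using \<open>V > 0\<close> divide_ennreal[of 1 V]
    by (intro density_cong) (auto simp: indicator_def)
  have "(LINT x|torus_measure. trig_monomial k x) =
      (LINT x|lborel. (indicat_real torus x / V) *\<^sub>R trig_monomial k x)"
    unfolding density using \<open>V > 0\<close> by (subst integral_density) auto
  also have "\<dots> = (LINT x|lborel. (1 / V) *\<^sub>R (indicat_real torus x *\<^sub>R trig_monomial k x))"
    by simp
  also have "\<dots> = (1 / V) *\<^sub>R (LINT x|lborel. indicat_real torus x *\<^sub>R trig_monomial k x)"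
    by (rule integral_scaleR_right)
  also have "(LINT x|lborel. indicat_real torus x *\<^sub>R trig_monomial k x) = 0"
  proof -
    \<comment> \<open>The factors must be indexed by basis vectors; the sum with the case
      distinction reads off \<open>k $ j\<close> from \<open>b = axis j 1\<close>.\<close>
    define g where "g = (\<lambda>b::real^'d. \<lambda>t.
      indicat_real {0..<2*pi} t *\<^sub>R exp (\<i> * of_int (\<Sum>j\<in>UNIV. if b = axis j 1 then k $ j else 0) * of_real t))"
    have g: "g (axis j 1) t = indicat_real {0..<2*pi} t *\<^sub>R exp (\<i> * of_int (k $ j) * of_real t)" for j t
      unfolding g_def by (simp add: axis_eq_axis)
    have ind: "indicat_real torus x = (\<Prod>j\<in>UNIV. indicat_real {0..<2*pi} (x $ j))" for x :: "real^'d"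
      by (auto simp: torus_def indicator_def)
    have "(LINT x|lborel. indicat_real torus x *\<^sub>R trig_monomial k x) =
      (LINT x|lborel. (\<Prod>b\<in>Basis. g b (x \<bullet> b)))"
      by (simp add: prod_Basis_vec g inner_axis ind trig_monomial_prod scaleR_conv_of_real prod.distrib)
    also have "\<dots> = (\<Prod>b\<in>Basis. LINT t|lborel. g b t)"
    proof (rule integral_lborel_prod)
      fix b :: "real^'d"
      show "integrable lborel (g b)"
        unfolding g_def
        by (rule integrableI_bounded_set[of "{0..<2*pi}" _ _ 1]) (auto simp: indicator_def)
    qed
    also have "\<dots> = (\<Prod>j\<in>UNIV. LINT t|lborel. g (axis j 1) t)"
      by (rule prod_Basis_vec)
    also have "\<dots> = 0"
    proof -
      obtain j where "k $ j \<noteq> 0" using assms by (auto simp: vec_eq_iff)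
      then show ?thesis
        by (auto simp: g integral_indicator_exp_period intro!: exI[of _ j])
    qed
    finally show ?thesis .
  qed
  finally show ?thesis by simp
qed

lemma integrable_trig_monomial [simp]: "integrable torus_measure (trig_monomial k)"
proof -
  interpret prob_space "torus_measure :: (real^'a) measure" by (rule prob_space_torus_measure)
  show ?thesis by (rule integrable_const_bound[of _ 1]) auto
qed

section \<open>Norms and sample averages as quadratic forms in the coefficients\<close>

text \<open>Follows from \<open>z * cnj z\<close> and the product rule for exponentials. The same
  expansion is then integrated over the torus and averaged over the sample points.\<close>

lemma cmod_sum_trig_monomial_sq:
  "of_real ((cmod (\<Sum>k\<in>Q. c k * trig_monomial k x))\<^sup>2) =
    (\<Sum>k\<in>Q. \<Sum>l\<in>Q. c k * cnj (c l) * trig_monomial (k - l) x)"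
proof -
  have "of_real ((cmod (\<Sum>k\<in>Q. c k * trig_monomial k x))\<^sup>2) =
      (\<Sum>k\<in>Q. c k * trig_monomial k x) * cnj (\<Sum>l\<in>Q. c l * trig_monomial l x)"
    by (metis complex_norm_square)
  also have "\<dots> = (\<Sum>k\<in>Q. \<Sum>l\<in>Q. (c k * trig_monomial k x) * (cnj (c l) * cnj (trig_monomial l x)))"
    by (simp add: sum_product)
  also have "\<dots> = (\<Sum>k\<in>Q. \<Sum>l\<in>Q. c k * cnj (c l) * trig_monomial (k - l) x)"
    by (intro sum.cong refl) (simp flip: trig_monomial_mult_cnj)
  finally show ?thesis .
qed

text \<open>Parseval's identity: by orthogonality only the diagonal terms \<open>k = l\<close>
  survive integration.\<close>

lemma L2_torus_sum_trig_monomial: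
  assumes "finite Q"
  shows "(L2_torus (\<lambda>x. \<Sum>k\<in>Q. c k * trig_monomial k x))\<^sup>2 = (\<Sum>k\<in>Q. (cmod (c k))\<^sup>2)"
proof -
  interpret prob_space "torus_measure :: (real^'a) measure" by (rule prob_space_torus_measure)
  have E: "(LINT x|torus_measure. trig_monomial h x) = (if h = 0 then 1 else 0)" for h :: "int^'a"
    by (simp add: integral_trig_monomial prob_space)
  let ?I = "LINT x|torus_measure. (cmod (\<Sum>k\<in>Q. c k * trig_monomial k x))\<^sup>2"
  have "complex_of_real ?I =
      (LINT x|torus_measure. (\<Sum>k\<in>Q. \<Sum>l\<in>Q. c k * cnj (c l) * trig_monomial (k - l) x))"
    by (simp only: cmod_sum_trig_monomial_sq flip: integral_complex_of_real)
  also have "\<dots> = (\<Sum>k\<in>Q. \<Sum>l\<in>Q. c k * cnj (c l) * (if k - l = 0 then 1 else 0))"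
    by (simp add: Bochner_Integration.integral_sum E del: right_minus_eq)
  also have "\<dots> = (\<Sum>k\<in>Q. c k * cnj (c k))"
    using assms by (simp add: if_distrib cong: if_cong)
  also have "\<dots> = complex_of_real (\<Sum>k\<in>Q. (cmod (c k))\<^sup>2)"
    by (simp only: of_real_sum complex_norm_square)
  finally have "?I = (\<Sum>k\<in>Q. (cmod (c k))\<^sup>2)"
    by (simp only: of_real_eq_iff)
  then show ?thesis
    by (simp add: L2_torus_def sum_nonneg)
qed

text \<open>The deviation is the quadratic form with matrix \<open>G (k - l) - \<delta> k l\<close>.
  Its diagonal vanishes since \<open>trig_monomial 0\<close> is 1, and the other entries are at most
  \<open>\<epsilon>\<close> in modulus by \<open>small\<close>.\<close>

lemma sample_average_approx_L2_torus:
  assumes "finite Q" "m \<ge> 1" "\<epsilon> \<ge> 0" and f: "f \<in> trig_polys Q"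
    and small: "\<And>k l. k \<in> Q \<Longrightarrow> l \<in> Q \<Longrightarrow> k \<noteq> l \<Longrightarrow>
      cmod (\<Sum>\<nu>=1..m. trig_monomial (k - l) (\<xi> \<nu>)) \<le> \<epsilon> * real m"
  shows "\<bar>(1 / real m) * (\<Sum>\<nu>=1..m. (cmod (f (\<xi> \<nu>)))\<^sup>2) - (L2_torus f)\<^sup>2\<bar>
    \<le> \<epsilon> * real (card Q) * (L2_torus f)\<^sup>2"
proof -
  obtain c where f: "f = (\<lambda>x. \<Sum>k\<in>Q. c k * trig_monomial k x)"
    using f by (auto simp: trig_polys_def trig_monomial_def)
  define G where "G = (\<lambda>h. (\<Sum>\<nu>=1..m. trig_monomial h (\<xi> \<nu>)) / of_nat m)"
  define \<delta> where "\<delta> = (\<lambda>k l :: int^'a. if k = l then 1 else 0 :: complex)"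
  have L2: "(L2_torus f)\<^sup>2 = (\<Sum>k\<in>Q. (cmod (c k))\<^sup>2)"
    unfolding f by (rule L2_torus_sum_trig_monomial) fact
  have "complex_of_real ((L2_torus f)\<^sup>2) = (\<Sum>k\<in>Q. c k * cnj (c k))"
    unfolding L2 by (simp only: of_real_sum complex_norm_square)
  also have "\<dots> = (\<Sum>k\<in>Q. \<Sum>l\<in>Q. c k * cnj (c l) * \<delta> k l)"
    using \<open>finite Q\<close> by (simp add: \<delta>_def if_distrib cong: if_cong)
  finally have 1: "complex_of_real ((L2_torus f)\<^sup>2) = \<dots>" .
  have "complex_of_real ((1 / real m) * (\<Sum>\<nu>=1..m. (cmod (f (\<xi> \<nu>)))\<^sup>2)) =
      (1 / of_nat m) * (\<Sum>\<nu>=1..m. \<Sum>k\<in>Q. \<Sum>l\<in>Q. c k * cnj (c l) * trig_monomial (k - l) (\<xi> \<nu>))"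
    by (simp only: f cmod_sum_trig_monomial_sq of_real_mult of_real_sum of_real_divide of_real_1 of_real_of_nat_eq)
  also have "(\<Sum>\<nu>=1..m. \<Sum>k\<in>Q. \<Sum>l\<in>Q. c k * cnj (c l) * trig_monomial (k - l) (\<xi> \<nu>)) =
      (\<Sum>k\<in>Q. \<Sum>l\<in>Q. \<Sum>\<nu>=1..m. c k * cnj (c l) * trig_monomial (k - l) (\<xi> \<nu>))"
    \<comment> \<open>The sum over the sample points moves inward past \<open>k\<close> and then
      past \<open>l\<close>.\<close>
    by (subst sum.swap, rule sum.cong[OF refl], rule sum.swap)
  also have "(1 / of_nat m) * \<dots> = (\<Sum>k\<in>Q. \<Sum>l\<in>Q. c k * cnj (c l) * G (k - l))"
    by (simp add: G_def sum_distrib_left mult_ac sum_divide_distrib)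
  finally have diff: "complex_of_real ((1 / real m) * (\<Sum>\<nu>=1..m. (cmod (f (\<xi> \<nu>)))\<^sup>2) - (L2_torus f)\<^sup>2) =
      (\<Sum>k\<in>Q. \<Sum>l\<in>Q. c k * cnj (c l) * (G (k - l) - \<delta> k l))"
    by (simp only: of_real_diff 1 sum_subtractf right_diff_distrib)
  have "\<bar>(1 / real m) * (\<Sum>\<nu>=1..m. (cmod (f (\<xi> \<nu>)))\<^sup>2) - (L2_torus f)\<^sup>2\<bar> =
      cmod (complex_of_real ((1 / real m) * (\<Sum>\<nu>=1..m. (cmod (f (\<xi> \<nu>)))\<^sup>2) - (L2_torus f)\<^sup>2))"
    by (rule norm_of_real[symmetric])
  also have "\<dots> = cmod (\<Sum>k\<in>Q. \<Sum>l\<in>Q. c k * cnj (c l) * (G (k - l) - \<delta> k l))"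
    by (simp only: diff)
  also have "\<dots> \<le> (\<Sum>k\<in>Q. \<Sum>l\<in>Q. cmod (c k) * cmod (c l) * \<epsilon>)"
  proof (intro sum_norm_le)
    fix k l assume kl: "k \<in> Q" "l \<in> Q"
    have "cmod (G (k - l) - \<delta> k l) \<le> \<epsilon>"
    proof (cases "k = l")
      case True
      then show ?thesis using \<open>m \<ge> 1\<close> \<open>\<epsilon> \<ge> 0\<close> by (simp add: G_def \<delta>_def)
    next
      case False
      then show ?thesis
        using small[OF kl False] \<open>m \<ge> 1\<close> by (simp add: G_def \<delta>_def norm_divide divide_simps)
    qed
    then show "cmod (c k * cnj (c l) * (G (k - l) - \<delta> k l)) \<le> cmod (c k) * cmod (c l) * \<epsilon>"
      by (simp add: norm_mult mult_left_mono)
  qed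
  also have "\<dots> = \<epsilon> * (\<Sum>k\<in>Q. cmod (c k))\<^sup>2"
    by (simp add: power2_eq_square sum_product sum_distrib_left mult_ac)
  \<comment> \<open>Cauchy--Schwarz; this is where the factor \<open>card Q\<close> arises, and why
    \<open>\<epsilon>\<close> of order \<open>1 / v\<close> suffices.\<close>
  also have "\<dots> \<le> \<epsilon> * ((\<Sum>k\<in>Q. (cmod (c k))\<^sup>2) * real (card Q))"
    using \<open>\<epsilon> \<ge> 0\<close> by (intro mult_left_mono sum_squared_le_sum_of_squares)
  finally show ?thesis by (simp add: L2 mult_ac)
qed

section \<open>Counting frequencies and bounding the exponential sums\<close>

lemma finite_card_freq_cube:
  assumes "n \<ge> 1"
  shows "finite (freq_cube n :: (int^'d::finite) set)"
    and "card (freq_cube n :: (int^'d) set) \<le> 2 ^ (n * CARD('d))"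
proof -
  define J where "J = {-(2 ^ (n - 1) - 1) .. 2 ^ (n - 1) - 1 :: int}"
  let ?F = "PiE (UNIV :: 'd set) (\<lambda>_. J)"
  have sub: "(freq_cube n :: (int^'d) set) \<subseteq> vec_lambda ` ?F"
  proof
    fix k :: "int^'d" assume "k \<in> freq_cube n"
    then have "\<bar>k $ j\<bar> \<le> 2 ^ (n - 1) - 1" for j
      by (simp add: freq_cube_def)
    then have "k $ j \<in> J" for j
      by (metis J_def abs_le_iff atLeastAtMost_iff minus_le_iff)
    then have "vec_nth k \<in> ?F" by auto
    then show "k \<in> vec_lambda ` ?F"
      by (metis image_eqI vec_nth_inverse)
  qed
  have fin: "finite ?F" by (auto intro!: finite_PiE simp: J_def)
  show "finite (freq_cube n :: (int^'d) set)"
    by (rule finite_subset[OF sub]) (use fin in simp)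
  have "card J \<le> 2 ^ n"
  proof -
    \<comment> \<open>The exact count is \<open>2 * 2 ^ (n - 1) - 1\<close>; it is rounded up to a
      power of 2.\<close>
    have "int (card J) \<le> 2 * 2 ^ (n - 1)" by (simp add: J_def)
    also have "\<dots> = int (2 ^ n)"
      using assms by (simp flip: power_Suc)
    finally show ?thesis by linarith
  qed
  have "card (freq_cube n :: (int^'d) set) \<le> card ?F"
    using fin sub by (rule surj_card_le)
  also have "\<dots> = card J ^ CARD('d)"
    by (simp add: card_PiE)
  also have "\<dots> \<le> (2 ^ n) ^ CARD('d)"
    using \<open>card J \<le> 2 ^ n\<close> by (rule power_mono) simp
  finally show "card (freq_cube n :: (int^'d) set) \<le> 2 ^ (n * CARD('d))"
    by (simp add: power_mult)
qed

text \<open>A Chernoff bound combined with a union bound over \<open>4 * card D\<close> real-valued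
  functions. Up to a constant, \<open>A\<close> is the logarithm of the permitted number of
  functions, and the accuracy \<open>1 / (2 * v)\<close> costs the factor \<open>v\<^sup>2\<close>
  in \<open>m\<close>.\<close>

lemma ex_points_trig_monomial_sum_le:
  fixes D :: "(int^'d::finite) set"
  assumes "finite D" "0 \<notin> D" "4 * card D \<le> 2 ^ A" "v \<ge> 1"
  defines "m \<equiv> 32 * v\<^sup>2 * A"
  shows "\<exists>\<xi>. inj_on \<xi> {1..m} \<and> \<xi> ` {1..m} \<subseteq> torus \<and>
    (\<forall>h\<in>D. cmod (\<Sum>\<nu>=1..m. trig_monomial h (\<xi> \<nu>)) \<le> real m / (2 * real v))"
proof -
  interpret prob_space "torus_measure :: (real^'d) measure" by (rule prob_space_torus_measure)
  \<comment> \<open>Multiplying by the four units turns upper bounds on real parts into bounds on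
    \<open>\<bar>Re\<bar>\<close> and \<open>\<bar>Im\<bar>\<close> of the complex sum.\<close>
  define I where "I = D \<times> {1, -1, \<i>, -\<i>}"
  define X where "X = (\<lambda>(h, z) x. Re (z * trig_monomial h (x :: real^'d)))"
  \<comment> \<open>With this \<open>l\<close> and \<open>m = 32 * v\<^sup>2 * A\<close>, the term
    \<open>m * l\<^sup>2 / 2\<close> equals \<open>A\<close>, and the target
    \<open>l * (m / (4 * v))\<close> equals \<open>2 * A\<close>.\<close>
  define l where "l = 1 / (4 * real v)"
  have l: "l > 0" using \<open>v \<ge> 1\<close> by (simp add: l_def)
  have bound: "\<bar>X i x\<bar> \<le> 1" if "i \<in> I" for i x
  proof -
    obtain h z where i: "i = (h, z)" by (cases i)
    have "\<bar>X i x\<bar> \<le> cmod (z * trig_monomial h x)"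
      unfolding X_def i by (simp only: prod.case abs_Re_le_cmod)
    also have "\<dots> = 1" using that by (auto simp: i I_def norm_mult)
    finally show ?thesis .
  qed
  have mean: "expectation (X i) = 0" if "i \<in> I" for i
  proof -
    obtain h z where i: "i = (h, z)" by (cases i)
    have "expectation (X i) = Re (LINT x|torus_measure. z * trig_monomial h x)"
      unfolding X_def i prod.case by (rule integral_Re) simp
    also have "\<dots> = 0"
    proof -
      have "h \<noteq> 0" using that assms(2) by (auto simp: i I_def)
      then show ?thesis by (simp add: integral_trig_monomial del: Re_sum times_complex.sel)
    qed
    finally show ?thesis .
  qed
  have "random_variable borel (X i)" if "i \<in> I" for i
  proof -
    obtain h z where i: "i = (h, z)" by (cases i)
    show ?thesis unfolding X_def i prod.case by measurable
  qed
  from ex_points_exp_sum_le[of I X l torus m, OF this bound mean l AE_torus_measure(2,1)]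
  obtain \<xi> where \<xi>: "inj_on \<xi> {1..m}" "\<xi> ` {1..m} \<subseteq> torus"
    and le: "(\<Sum>i\<in>I. exp (l * (\<Sum>\<nu>=1..m. X i (\<xi> \<nu>)))) \<le> real (card I) * exp (real m * l\<^sup>2 / 2)"
    by blast
  have "finite I" using assms(1) by (simp add: I_def)
  have "card I = card D * card {1, -1, \<i>, -\<i>}"
    unfolding I_def by (rule card_cartesian_product)
  also have "\<dots> \<le> card D * 4"
    by (intro mult_left_mono) (auto simp: card_insert_if)
  also have "\<dots> \<le> 2 ^ A" using assms(3) by simp
  finally have "real (card I) \<le> 2 ^ A"
    by (metis of_nat_le_iff of_nat_numeral of_nat_power)
  also have "\<dots> \<le> exp 1 ^ A"
    using exp_ge_add_one_self[of 1] by (intro power_mono) auto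
  also have "\<dots> = exp (real A)"
    by (simp flip: exp_of_nat_mult)
  finally have card_I: "real (card I) \<le> exp (real A)" .
  have S: "(\<Sum>\<nu>=1..m. X i (\<xi> \<nu>)) \<le> real m / (4 * real v)" if "i \<in> I" for i
  proof -
    \<comment> \<open>The union bound: each positive term is at most the whole sum, and taking
      logarithms bounds every partial sum at once.\<close>
    have "exp (l * (\<Sum>\<nu>=1..m. X i (\<xi> \<nu>))) \<le> (\<Sum>i\<in>I. exp (l * (\<Sum>\<nu>=1..m. X i (\<xi> \<nu>))))"
      using \<open>finite I\<close> that by (intro member_le_sum) auto
    also have "\<dots> \<le> real (card I) * exp (real m * l\<^sup>2 / 2)" by (rule le)
    also have "\<dots> \<le> exp (real A) * exp (real m * l\<^sup>2 / 2)"
      using card_I by (intro mult_right_mono) auto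
    finally have "l * (\<Sum>\<nu>=1..m. X i (\<xi> \<nu>)) \<le> real A + real m * l\<^sup>2 / 2"
      by (simp add: mult_exp_exp)
    also have "\<dots> = l * (real m / (4 * real v))"
      using \<open>v \<ge> 1\<close> by (simp add: l_def m_def power2_eq_square field_simps)
    finally show ?thesis using l by (simp only: mult_le_cancel_left_pos)
  qed
  have "cmod (\<Sum>\<nu>=1..m. trig_monomial h (\<xi> \<nu>)) \<le> real m / (2 * real v)" if "h \<in> D" for h
  proof -
    let ?T = "\<Sum>\<nu>=1..m. trig_monomial h (\<xi> \<nu>)"
    have "Re (z * ?T) \<le> real m / (4 * real v)" if "z \<in> {1, -1, \<i>, -\<i>}" for z
      using S[of "(h, z)"] \<open>h \<in> D\<close> that unfolding I_def X_def
      by (simp only: mem_Sigma_iff prod.case sum_distrib_left Re_sum simp_thms)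
    from this[of 1] this[of "-1"] this[of "\<i>"] this[of "-\<i>"]
    have "\<bar>Re ?T\<bar> \<le> real m / (4 * real v)" "\<bar>Im ?T\<bar> \<le> real m / (4 * real v)"
      by (simp_all del: Re_sum Im_sum)
    \<comment> \<open>The modulus is at most \<open>\<bar>Re ?T\<bar> + \<bar>Im ?T\<bar>\<close>,
      which doubles \<open>m / (4 * v)\<close>.\<close>
    with cmod_le[of ?T] show ?thesis by simp
  qed
  with \<xi> show ?thesis by blast
qed

section \<open>Universal discretization with explicit constants\<close>

theorem theorem7p4:
  "\<exists>C1 C2 C3 :: real. C1 > 0 \<and> C2 > 0 \<and> C3 > 0 \<and>
    (\<forall>n v :: nat. n \<ge> 1 \<longrightarrow> v \<ge> 1 \<longrightarrow> v \<le> card (freq_cube n :: (int^'d::finite) set) \<longrightarrow>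
      (\<exists>(m :: nat) (\<xi> :: nat \<Rightarrow> real^'d).
         m \<ge> 1 \<and> inj_on \<xi> {1..m} \<and> \<xi> ` {1..m} \<subseteq> torus \<and>
         real m \<le> C1 * (real v)\<^sup>2 * real n \<and>
         (\<forall>f \<in> (\<Union>Q \<in> freq_subsets v n. trig_polys Q).
            C2 * (L2_torus f)\<^sup>2 \<le> (1 / real m) * (\<Sum>\<nu>=1..m. (norm (f (\<xi> \<nu>)))\<^sup>2) \<and>
            (1 / real m) * (\<Sum>\<nu>=1..m. (norm (f (\<xi> \<nu>)))\<^sup>2) \<le> C3 * (L2_torus f)\<^sup>2)))"
proof (rule exI[of _ "64 * (1 + real CARD('d))"], rule exI[of _ "1/2"], rule exI[of _ "3/2"],
    intro conjI allI impI)
  fix n v :: nat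
  assume "n \<ge> 1" "v \<ge> 1"
  \<comment> \<open>Of the exponent \<open>A\<close>, the part \<open>2 * n * CARD('d)\<close>
    counts pairs of frequencies and the part \<open>2 * n\<close> absorbs the factor 4, as
    \<open>n \<ge> 1\<close>. Then \<open>m = 64 * (1 + CARD('d)) * v\<^sup>2 * n\<close>, whence
    the first constant.\<close>
  define A where "A = 2 * n * (1 + CARD('d))"
  define m where "m = 32 * v\<^sup>2 * A"
  define P where "P = (freq_cube n :: (int^'d) set)"
  \<comment> \<open>All differences within the cube are taken, not those of one \<open>Q\<close>:
    the points are chosen before \<open>Q\<close>, and this makes the discretization
    universal.\<close>
  define D where "D = (\<lambda>(k, l). k - l) ` (P \<times> P) - {0}"
  note P = finite_card_freq_cube[OF \<open>n \<ge> 1\<close>, where 'd='d, folded P_def]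
  have "m \<ge> 1"
    using \<open>n \<ge> 1\<close> \<open>v \<ge> 1\<close> by (simp add: m_def A_def Suc_le_eq)
  have "card D \<le> card ((\<lambda>(k, l). k - l) ` (P \<times> P))"
    unfolding D_def using P by (intro card_mono) auto
  also have "\<dots> \<le> card (P \<times> P)"
    using P by (intro card_image_le) auto
  also have "\<dots> \<le> 2 ^ (n * CARD('d)) * 2 ^ (n * CARD('d))"
    unfolding card_cartesian_product using P by (intro mult_mono) auto
  finally have D: "card D \<le> 2 ^ (2 * n * CARD('d))"
    by (simp add: mult_2 add_mult_distrib power_add)
  have "(4::nat) = 2 ^ 2" by simp
  also have "\<dots> \<le> 2 ^ (2 * n)"
    using \<open>n \<ge> 1\<close> by (intro power_increasing) auto
  finally have "4 * card D \<le> 2 ^ (2 * n) * 2 ^ (2 * n * CARD('d))"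
    using D by (intro mult_mono) auto
  also have "\<dots> = 2 ^ A"
    by (simp add: A_def flip: power_add)
  finally have "4 * card D \<le> 2 ^ A" .
  moreover have "finite D" "0 \<notin> D"
    using P by (auto simp: D_def)
  ultimately obtain \<xi> where \<xi>: "inj_on \<xi> {1..m}" "\<xi> ` {1..m} \<subseteq> torus"
    and sums: "\<And>h. h \<in> D \<Longrightarrow> cmod (\<Sum>\<nu>=1..m. trig_monomial h (\<xi> \<nu>)) \<le> real m / (2 * real v)"
    using ex_points_trig_monomial_sum_le[of D A v] \<open>v \<ge> 1\<close> unfolding m_def by blast
  have "1/2 * (L2_torus f)\<^sup>2 \<le> (1 / real m) * (\<Sum>\<nu>=1..m. (norm (f (\<xi> \<nu>)))\<^sup>2) \<and>
        (1 / real m) * (\<Sum>\<nu>=1..m. (norm (f (\<xi> \<nu>)))\<^sup>2) \<le> 3/2 * (L2_torus f)\<^sup>2"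
    if "f \<in> (\<Union>Q \<in> freq_subsets v n. trig_polys Q)" for f
  proof -
    obtain Q where Q: "Q \<subseteq> P" "card Q = v" and f: "f \<in> trig_polys Q"
      using \<open>f \<in> _\<close> by (auto simp: freq_subsets_def P_def)
    have "cmod (\<Sum>\<nu>=1..m. trig_monomial (k - l) (\<xi> \<nu>)) \<le> 1 / (2 * real v) * real m"
      if "k \<in> Q" "l \<in> Q" "k \<noteq> l" for k l
      using sums[of "k - l"] that Q by (auto simp: D_def)
    \<comment> \<open>Here \<open>\<epsilon> = 1 / (2 * v)\<close> and \<open>card Q = v\<close>, so
      the relative error is \<open>1/2\<close>; this gives the constants \<open>1/2\<close> and
      \<open>3/2\<close>.\<close>
    from sample_average_approx_L2_torus[OF finite_subset[OF Q(1) P(1)] \<open>m \<ge> 1\<close> _ f this]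
    have "\<bar>(1 / real m) * (\<Sum>\<nu>=1..m. (cmod (f (\<xi> \<nu>)))\<^sup>2) - (L2_torus f)\<^sup>2\<bar> \<le> 1/2 * (L2_torus f)\<^sup>2"
      using Q \<open>v \<ge> 1\<close> by simp
    then show ?thesis
      unfolding abs_le_iff by linarith
  qed
  moreover have "real m \<le> 64 * (1 + real CARD('d)) * (real v)\<^sup>2 * real n"
    by (simp add: m_def A_def algebra_simps)
  ultimately show "\<exists>(m :: nat) (\<xi> :: nat \<Rightarrow> real^'d).
         m \<ge> 1 \<and> inj_on \<xi> {1..m} \<and> \<xi> ` {1..m} \<subseteq> torus \<and>
         real m \<le> 64 * (1 + real CARD('d)) * (real v)\<^sup>2 * real n \<and>
         (\<forall>f \<in> (\<Union>Q \<in> freq_subsets v n. trig_polys Q).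
            1/2 * (L2_torus f)\<^sup>2 \<le> (1 / real m) * (\<Sum>\<nu>=1..m. (norm (f (\<xi> \<nu>)))\<^sup>2) \<and>
            (1 / real m) * (\<Sum>\<nu>=1..m. (norm (f (\<xi> \<nu>)))\<^sup>2) \<le> 3/2 * (L2_torus f)\<^sup>2)"
    using \<open>m \<ge> 1\<close> \<xi> by blast
qed auto

end
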